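(* Let $n\ge 5$. There exists a positive constant $c_2$ depending only on $n$ such that for every integer $N\ge 3$ with $|\mathcal{L}_n(N)|>0$ we have $|\mathcal{L}_n(N)|\ge c_2N^{\frac{3}{n-1}-\frac{4}{\log\log N}}$, and for every integer $N\ge3$ with $|\mathcal{L}_{\ge n}(N)|>0$ we have $|\mathcal{L}_{\ge n}(N)|\ge c_2N^{\frac{3}{n-1}-\frac{4}{\log\log N}}$.
   Context: For integers $A,B$ the Lucas sequence $U$ is $U_0=0$, $U_1=1$, $U_n=AU_{n-1}-BU_{n-2}$ $(n\ge2)$; with $\alpha,\beta$ the roots of $x^2-Ax+B$, $U$ is non-degenerate if $AB\neq0$ and $\alpha/\beta$ is not a root of unity. $\mathcal{L}_n(N)$ is the set of integers $x$ with $0\le x\le N$ and $x=|U_n|$ for some non-degenerate Lucas sequence $U$, and $\mathcal{L}_{\ge n}(N)=\bigcup_{m\ge n}\mathcal{L}_m(N)$. $\log$ is the natural logarithm. *)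

theory Defs
  imports "HOL-Analysis.Analysis" "HOL-Computational_Algebra.Polynomial"
begin

fun lucas_U :: "int \<Rightarrow> int \<Rightarrow> nat \<Rightarrow> int" where
  "lucas_U A B 0 = 0"
| "lucas_U A B (Suc 0) = 1"
| "lucas_U A B (Suc (Suc n)) = A * lucas_U A B (Suc n) - B * lucas_U A B n"

definition root_of_unity :: "complex \<Rightarrow> bool" where
  "root_of_unity z \<longleftrightarrow> (\<exists>k>0. z ^ k = 1)"

text \<open>The roots are taken with multiplicity. A double root makes the sequence degenerate, as the
  quotient of the roots is then 1.\<close>

definition char_roots :: "int \<Rightarrow> int \<Rightarrow> complex \<Rightarrow> complex \<Rightarrow> bool" where
  "char_roots A B \<alpha> \<beta> \<longleftrightarrow>
     [:of_int B, - of_int A, 1:] = [:- \<alpha>, 1:] * [:- \<beta>, 1:]"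

definition nondegenerate :: "int \<Rightarrow> int \<Rightarrow> bool" where
  "nondegenerate A B \<longleftrightarrow>
     A * B \<noteq> 0 \<and> (\<forall>\<alpha> \<beta>. char_roots A B \<alpha> \<beta> \<longrightarrow> \<not> root_of_unity (\<alpha> / \<beta>))"

definition lucas_values :: "nat \<Rightarrow> int \<Rightarrow> int set" where
  "lucas_values n N =
     {x. 0 \<le> x \<and> x \<le> N \<and> (\<exists>A B. nondegenerate A B \<and> x = \<bar>lucas_U A B n\<bar>)}"

definition lucas_values_ge :: "nat \<Rightarrow> int \<Rightarrow> int set" where
  "lucas_values_ge n N = (\<Union>m\<in>{n..}. lucas_values m N)"

text \<open>The quantification over roots in \<open>nondegenerate\<close> is never vacuous, and both sets are finite,
  so that \<open>card\<close> is their number of elements.\<close>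

lemma char_roots_exist: "\<exists>\<alpha> \<beta>. char_roots A B \<alpha> \<beta>"
proof -
  define s :: complex where "s = csqrt (of_int A ^ 2 - 4 * of_int B)"
  have s: "s * s = of_int A * of_int A - 4 * of_int B"
    using power2_csqrt[of "of_int A ^ 2 - 4 * of_int B"] by (simp add: s_def power2_eq_square)
  have "char_roots A B ((of_int A + s) / 2) ((of_int A - s) / 2)"
    using s by (simp add: char_roots_def field_simps)
  then show ?thesis by blast
qed

lemma finite_lucas_values: "finite (lucas_values n N)"
  by (rule finite_subset[of _ "{0..N}"]) (auto simp: lucas_values_def)

lemma finite_lucas_values_ge: "finite (lucas_values_ge n N)"
  by (rule finite_subset[of _ "{0..N}"]) (auto simp: lucas_values_ge_def lucas_values_def)

end

theory Submission
  imports Defs "HOL-Computational_Algebra.Computational_Algebra" "HOL-Real_Asymp.Real_Asymp"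
begin

text \<open>Values are counted through parameters \<open>A = a > 0\<close>, \<open>B = - b < 0\<close> with \<open>a\<close> of size
  \<open>X\<close>, \<open>b\<close> up to the order of \<open>X\<^sup>2\<close> and \<open>X\<close> of size \<open>N powr (1 / (n - 1))\<close>. These sequences are
  positive and non-degenerate, and coprime pairs with \<open>a \<equiv> 1\<close>, \<open>b \<equiv> 0\<close> modulo \<open>fact (2 * n)\<close>
  make up a positive proportion of the roughly \<open>X ^ 3\<close> pairs. It remains to bound the number of
  pairs with a common value \<open>x\<close>, which is coprime to \<open>2 * n\<close>.

  With \<open>\<alpha>\<close>, \<open>\<beta>\<close> the characteristic roots, \<open>c = \<alpha> / \<beta> + \<beta> / \<alpha>\<close> satisfies
  \<open>c * B = A\<^sup>2 - 2 * B\<close>, and modulo \<open>x\<close> it is a root of \<open>(c + 2) * U\<^sub>n(c, 1)\<close>, a monic polynomial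
  of degree \<open>n\<close> whose roots modulo primes not dividing \<open>2 * n\<close> are simple. So \<open>c\<close> takes at most
  \<open>n ^ k\<close> values modulo a product \<open>g\<close> of \<open>k\<close> prime powers exactly dividing \<open>x\<close>. Two pairs with the
  same \<open>c\<close> modulo \<open>g\<close> satisfy \<open>a\<^sup>2 * b' \<equiv> a'\<^sup>2 * b\<close> modulo \<open>g\<close>, which for \<open>g \<ge> X ^ 4\<close> is an
  equality and forces the pairs to coincide. As \<open>x \<ge> X ^ (n - 1)\<close>, about
  \<open>k = \<omega>(x) / q\<close> prime powers with \<open>q = (n - 1) div 4\<close> suffice for such a \<open>g\<close>. Since
  \<open>n \<le> 8 ^ q\<close>, the fibre has at most \<open>n * 8 ^ \<omega>(x)\<close> elements, and
  \<open>8 ^ \<omega>(x) \<le> N powr (4 / ln (ln N))\<close> for large \<open>N\<close> because \<open>3 / 2 * ln 8 < 4\<close>.\<close>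

section \<open>Lucas sequences modulo an integer\<close>

lemma lucas_U_add:
  "lucas_U A B (m + k + 1) = lucas_U A B (m + 1) * lucas_U A B (k + 1) - B * lucas_U A B m * lucas_U A B k"
proof (induction k rule: induct_nat_012)
  case (ge2 k)
  have "lucas_U A B (m + Suc (Suc k) + 1) = A * lucas_U A B (m + Suc k + 1) - B * lucas_U A B (m + k + 1)"
    by simp
  then show ?case unfolding ge2 by (simp add: algebra_simps)
qed (simp_all add: algebra_simps)

lemma lucas_U_dvd_double: "lucas_U A B n dvd lucas_U A B (2 * n)"
proof (cases n)
  case (Suc k)
  have "lucas_U A B (2 * n) = lucas_U A B (n + k + 1)" using Suc by (simp add: mult_2)
  also have "\<dots> = lucas_U A B n * (lucas_U A B (n + 1) - B * lucas_U A B k)"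
    unfolding lucas_U_add using Suc by (simp add: algebra_simps)
  finally show ?thesis by simp
qed simp

text \<open>\<open>A\<^sup>2 - 2 * B\<close> and \<open>B\<^sup>2\<close> are the sum and product of
  the squares of the characteristic roots, so every second term obeys the recurrence with these
  parameters.\<close>

lemma lucas_U_add_4:
  "lucas_U A B (m + 4) = (A\<^sup>2 - 2 * B) * lucas_U A B (m + 2) - B\<^sup>2 * lucas_U A B m"
  by (simp add: eval_nat_numeral algebra_simps)

lemma lucas_U_mod_B: "B dvd lucas_U A B (Suc n) - A ^ n"
proof (induction n rule: induct_nat_012)
  case (ge2 n)
  have "lucas_U A B (Suc (Suc (Suc n))) - A ^ Suc (Suc n)
      = A * (lucas_U A B (Suc (Suc n)) - A ^ Suc n) - B * lucas_U A B (Suc n)"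
    by (simp add: algebra_simps)
  then show ?case using ge2 by (metis dvd_diff dvd_mult dvd_triv_left)
qed simp_all

text \<open>By \<open>lucas_U_add_4\<close> the even-indexed terms obey, modulo \<open>m\<close>,
  the recurrence with parameters \<open>c * B\<close> and \<open>B\<^sup>2\<close>; scaling by
  powers of \<open>B\<close> turns it into that of \<open>lucas_U c 1\<close>. The extra factor
  \<open>B\<close> on the left avoids the exponent \<open>j - 1\<close>.\<close>

lemma lucas_U_even_cong:
  assumes "m dvd A\<^sup>2 - (c + 2) * B"
  shows "m dvd B * lucas_U A B (2 * j) - A * B ^ j * lucas_U c 1 j"
proof (induction j rule: induct_nat_012)
  case (ge2 j)
  have *: "lucas_U A B (2 * Suc (Suc j)) = (A\<^sup>2 - 2 * B) * lucas_U A B (2 * Suc j) - B\<^sup>2 * lucas_U A B (2 * j)"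
    using lucas_U_add_4[of A B "2 * j"] by (simp add: eval_nat_numeral)
  have "B * lucas_U A B (2 * Suc (Suc j)) - A * B ^ Suc (Suc j) * lucas_U c 1 (Suc (Suc j))
     = c * B * (B * lucas_U A B (2 * Suc j) - A * B ^ Suc j * lucas_U c 1 (Suc j))
      - B\<^sup>2 * (B * lucas_U A B (2 * j) - A * B ^ j * lucas_U c 1 j)
      + (A\<^sup>2 - (c + 2) * B) * (B * lucas_U A B (2 * Suc j))"
    unfolding * lucas_U.simps by (simp add: algebra_simps power2_eq_square)
  then show ?case using ge2 assms by (metis dvd_add dvd_diff dvd_mult dvd_mult2)
qed (simp_all add: eval_nat_numeral)

section \<open>The polynomial (c + 2) U_n(c, 1) and its simple roots modulo primes\<close>

fun lucas_poly :: "nat \<Rightarrow> int poly" where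
  "lucas_poly 0 = 0"
| "lucas_poly (Suc 0) = 1"
| "lucas_poly (Suc (Suc n)) = [:0, 1:] * lucas_poly (Suc n) - lucas_poly n"

declare lucas_poly.simps(3) [simp del]

text \<open>The factor \<open>c + 2\<close> allows for an \<open>A\<close> that is not invertible
  modulo \<open>m\<close>: the right-hand term of \<open>lucas_U_even_cong\<close> contains
  \<open>A\<close>, and one more multiplication by \<open>A\<close> produces
  \<open>A\<^sup>2\<close>, which is congruent to \<open>(c + 2) * B\<close>.\<close>

definition class_poly :: "nat \<Rightarrow> int poly" where
  "class_poly n = [:2, 1:] * lucas_poly n"

lemma poly_lucas_poly: "poly (lucas_poly n) c = lucas_U c 1 n"
  by (induction n rule: induct_nat_012) (simp_all add: lucas_poly.simps(3))

lemma poly_class_poly: "poly (class_poly n) c = (c + 2) * lucas_U c 1 n"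
  by (simp add: class_poly_def poly_lucas_poly algebra_simps)

lemma lucas_poly_monic: "degree (lucas_poly (Suc n)) = n \<and> lead_coeff (lucas_poly (Suc n)) = 1"
proof (induction n rule: induct_nat_012)
  case (ge2 n)
  define p q where "p = lucas_poly (Suc n)" and "q = lucas_poly (Suc (Suc n))"
  have pq: "degree p = n" "degree q = Suc n" "lead_coeff q = 1" using ge2 by (auto simp: p_def q_def)
  have "q \<noteq> 0" using pq by auto
  then have d: "degree (pCons 0 q) = n + 2" "lead_coeff (pCons 0 q) = 1" using pq by auto
  have "degree (- p) < degree (pCons 0 q)" using pq d by simp
  then have "degree (pCons 0 q + - p) = n + 2 \<and> lead_coeff (pCons 0 q + - p) = 1"
    using d by (metis degree_add_eq_left lead_coeff_add_le add.commute)
  then show ?case using lucas_poly.simps(3)[of "Suc n"] by (auto simp: p_def q_def)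
qed (simp_all add: lucas_poly.simps(3))

lemma class_poly_monic:
  assumes "n > 0"
  shows "degree (class_poly n) = n" "lead_coeff (class_poly n) = 1"
proof -
  obtain k where n: "n = Suc k" using assms by (cases n) auto
  have "lucas_poly n \<noteq> 0" using lucas_poly_monic[of k] n by auto
  then have "degree (class_poly n) = degree [:2, 1 :: int:] + degree (lucas_poly n)"
    unfolding class_poly_def by (intro degree_mult_eq) auto
  then show "degree (class_poly n) = n" using lucas_poly_monic[of k] n by simp
  show "lead_coeff (class_poly n) = 1"
    unfolding class_poly_def lead_coeff_mult using lucas_poly_monic[of k] n by auto
qed

text \<open>The divisibility passes to index \<open>2 * n\<close>, where the congruence for even
  indices applies. After multiplication by \<open>A\<close>, what remains is
  \<open>class_poly\<close> times a power of \<open>B\<close>, which cancels.\<close>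

lemma dvd_class_poly:
  assumes "m dvd lucas_U A B n" and "m dvd A\<^sup>2 - (c + 2) * B" and "coprime m B"
  shows "m dvd poly (class_poly n) c"
proof -
  have "m dvd A * B * lucas_U A B (2 * n)"
    using assms(1) lucas_U_dvd_double dvd_mult dvd_trans by blast
  moreover have "m dvd A * (B * lucas_U A B (2 * n) - A * B ^ n * lucas_U c 1 n)"
    using lucas_U_even_cong[OF assms(2)] by simp
  moreover have "m dvd (A\<^sup>2 - (c + 2) * B) * (B ^ n * lucas_U c 1 n)" using assms(2) by simp
  ultimately have "m dvd A * B * lucas_U A B (2 * n) - A * (B * lucas_U A B (2 * n) - A * B ^ n * lucas_U c 1 n)
      - (A\<^sup>2 - (c + 2) * B) * (B ^ n * lucas_U c 1 n)" by (intro dvd_diff)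
  also have "\<dots> = B ^ Suc n * poly (class_poly n) c"
    by (simp add: poly_class_poly algebra_simps power2_eq_square)
  finally show ?thesis using assms(3) by (meson coprime_dvd_mult_right_iff coprime_power_right_iff)
qed

text \<open>With \<open>c = t + 1/t\<close> the sequence is
  \<open>(t^n - t^(-n)) / (t - 1/t)\<close>, and the bracket after \<open>int n\<close> is
  \<open>t^n + t^(-n)\<close>. The identity is the derivative of this quotient with respect to
  \<open>c\<close>, cleared of the denominator \<open>(t - 1/t)^2 = c^2 - 4\<close>.\<close>

lemma lucas_poly_deriv:
  fixes c :: int
  shows "(c\<^sup>2 - 4) * poly (pderiv (lucas_poly n)) c
    = int n * (2 * lucas_U c 1 (Suc n) - c * lucas_U c 1 n) - c * lucas_U c 1 n"
proof (induction n rule: induct_nat_012)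
  case (ge2 n)
  have rec: "poly (pderiv (lucas_poly (Suc (Suc n)))) c = lucas_U c 1 (Suc n)
      + c * poly (pderiv (lucas_poly (Suc n))) c - poly (pderiv (lucas_poly n)) c"
    unfolding lucas_poly.simps pderiv_diff pderiv_mult by (simp add: pderiv_pCons poly_lucas_poly)
  have "(c\<^sup>2 - 4) * poly (pderiv (lucas_poly (Suc (Suc n)))) c = (c\<^sup>2 - 4) * lucas_U c 1 (Suc n)
      + c * ((c\<^sup>2 - 4) * poly (pderiv (lucas_poly (Suc n))) c) - (c\<^sup>2 - 4) * poly (pderiv (lucas_poly n)) c"
    unfolding rec by (simp add: algebra_simps)
  then show ?case unfolding ge2 by (simp add: algebra_simps power2_eq_square)
qed (simp_all add: algebra_simps power2_eq_square pderiv_1)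

text \<open>Thanks to the factor \<open>c + 2\<close> of \<open>class_poly\<close>, the multiplier
  \<open>c\<^sup>2 - 4\<close> shrinks to \<open>c - 2\<close>, so the identity stays informative
  where \<open>c\<close> is congruent to -2.\<close>

lemma class_poly_deriv:
  fixes c :: int
  shows "(c - 2) * poly (pderiv (class_poly n)) c
    = int n * (2 * lucas_U c 1 (Suc n) - c * lucas_U c 1 n) - 2 * lucas_U c 1 n"
proof -
  have "poly (pderiv (class_poly n)) c = lucas_U c 1 n + (c + 2) * poly (pderiv (lucas_poly n)) c"
    unfolding class_poly_def pderiv_mult by (simp add: pderiv_pCons poly_lucas_poly algebra_simps)
  then have "(c - 2) * poly (pderiv (class_poly n)) c
      = (c - 2) * lucas_U c 1 n + (c\<^sup>2 - 4) * poly (pderiv (lucas_poly n)) c"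
    by (simp add: algebra_simps power2_eq_square)
  then show ?thesis unfolding lucas_poly_deriv by (simp add: algebra_simps)
qed

lemma lucas_U_cassini: "(lucas_U c 1 (Suc n))\<^sup>2 - c * lucas_U c 1 (Suc n) * lucas_U c 1 n + (lucas_U c 1 n)\<^sup>2 = 1"
  by (induction n) (simp_all add: algebra_simps power2_eq_square)

text \<open>At a double root the right side of \<open>class_poly_deriv\<close> vanishes modulo
  \<open>p\<close>. If \<open>p\<close> divides U_n(c, 1), this forces \<open>p\<close> to divide
  U_(n+1)(c, 1) too, against \<open>lucas_U_cassini\<close>. If \<open>c\<close> is congruent to -2,
  the right side is \<open>4 * n\<close> up to sign.\<close>

lemma class_poly_simple_root:
  fixes p c :: int
  assumes "prime p" and "\<not> p dvd 2 * int n" and "p dvd poly (class_poly n) c"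
  shows "\<not> p dvd poly (pderiv (class_poly n)) c"
proof
  assume "p dvd poly (pderiv (class_poly n)) c"
  then have d: "p dvd int n * (2 * lucas_U c 1 (Suc n) - c * lucas_U c 1 n) - 2 * lucas_U c 1 n" (is "p dvd ?D")
    unfolding class_poly_deriv[symmetric] by simp
  have "p dvd c + 2 \<or> p dvd lucas_U c 1 n"
    using assms(1,3) by (simp add: poly_class_poly prime_dvd_mult_iff)
  then show False
  proof
    assume u: "p dvd lucas_U c 1 n"
    have "p dvd ?D + lucas_U c 1 n * (int n * c + 2)" using d u by simp
    also have "\<dots> = 2 * int n * lucas_U c 1 (Suc n)" by (simp add: algebra_simps)
    finally have v: "p dvd lucas_U c 1 (Suc n)" using assms(1,2) by (simp add: prime_dvd_mult_iff)
    have "p dvd (lucas_U c 1 (Suc n))\<^sup>2 - c * lucas_U c 1 (Suc n) * lucas_U c 1 n + (lucas_U c 1 n)\<^sup>2"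
      using u v by (simp add: power2_eq_square)
    then show False using assms(1) not_prime_unit[of p] unfolding lucas_U_cassini by blast
  next
    assume c: "p dvd c + 2"
    \<comment> \<open>Modulo \<open>p\<close> the characteristic polynomial is
      \<open>(x + 1)^2\<close>, whose double root -1 gives this closed form.\<close>
    have f: "p dvd lucas_U c 1 k - (-1) ^ Suc k * int k" for k
    proof (induction k rule: induct_nat_012)
      case (ge2 k)
      have "lucas_U c 1 (Suc (Suc k)) - (-1) ^ Suc (Suc (Suc k)) * int (Suc (Suc k)) =
        c * (lucas_U c 1 (Suc k) - (-1) ^ Suc (Suc k) * int (Suc k))
        - (lucas_U c 1 k - (-1) ^ Suc k * int k) + (c + 2) * ((-1) ^ k * int (Suc k))"
        by (simp add: algebra_simps)
      then show ?case using ge2 c by (metis dvd_add dvd_diff dvd_mult dvd_mult2)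
    qed simp_all
    have "p dvd ?D - int n * 2 * (lucas_U c 1 (Suc n) - (-1) ^ Suc (Suc n) * int (Suc n))
      + (int n * c + 2) * (lucas_U c 1 n - (-1) ^ Suc n * int n) - (c + 2) * (int n * int n * (-1) ^ n)"
      (is "p dvd ?E")
      by (rule dvd_diff[OF dvd_add[OF dvd_diff[OF d dvd_mult[OF f]] dvd_mult[OF f]] dvd_mult2[OF c]])
    also have "?E = 2 * (2 * int n) * (-1) ^ n" by (simp add: algebra_simps)
    finally have "p dvd 2 * (2 * int n)" by (auto simp: minus_one_power_iff split: if_splits)
    then show False using assms(1,2) by (metis dvd_mult2 prime_dvd_mult_iff)
  qed
qed

section \<open>Roots of integer polynomials modulo an integer\<close>

text \<open>Lagrange's bound over the field with \<open>p\<close> elements, with roots represented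
  by incongruent integers. Splitting off \<open>X - s\<close> leaves a quotient that vanishes modulo
  \<open>p\<close> at all other roots, as \<open>p\<close> is prime.\<close>

lemma card_incongruent_roots_le:
  fixes P :: "int poly"
  assumes "prime p" and "degree P \<le> d" and "\<not> p dvd coeff P d" and "finite R"
    and "\<And>r. r \<in> R \<Longrightarrow> p dvd poly P r" and "inj_on (\<lambda>r. r mod p) R"
  shows "card R \<le> d"
  using assms(2-)
proof (induction d arbitrary: P R)
  case 0
  then obtain c where P: "P = [:c:]" using degree_eq_zeroE by blast
  then have "R = {}" using 0 by auto
  then show ?case by simp
next
  case (Suc d)
  show ?case
  proof (cases "R = {}")
    case False
    then obtain s where s: "s \<in> R" by blast
    define Q where "Q = synthetic_div P s"
    have PQ: "P = [:- s, 1:] * Q + [:poly P s:]"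
      unfolding Q_def by (rule synthetic_div_correct'[symmetric])
    have dQ: "degree Q \<le> d" using Suc.prems(1) by (simp add: Q_def degree_synthetic_div)
    have "coeff P (Suc d) = coeff Q d" 
    proof -
      have "coeff P (Suc d) = coeff ([:- s, 1:] * Q + [:poly P s:]) (Suc d)" using PQ by simp
      also have "\<dots> = coeff Q d" using dQ by (simp add: coeff_eq_0)
      finally show ?thesis .
    qed
    then have lQ: "\<not> p dvd coeff Q d" using Suc.prems(2) by simp
    have "card (R - {s}) \<le> d"
    proof (rule Suc.IH[OF dQ lQ])
      show "inj_on (\<lambda>r. r mod p) (R - {s})" using Suc.prems(5) by (rule inj_on_subset) auto
      fix r assume r: "r \<in> R - {s}"
      then have "r mod p \<noteq> s mod p" using Suc.prems(5) s by (auto dest: inj_onD)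
      then have n: "\<not> p dvd r - s" by (simp add: mod_eq_dvd_iff)
      have "poly P r = (r - s) * poly Q r + poly P s" by (subst PQ) (simp add: algebra_simps)
      then have "p dvd (r - s) * poly Q r" using r s Suc.prems(4) by (metis DiffD1 dvd_add_left_iff)
      then show "p dvd poly Q r" using n assms(1) by (simp add: prime_dvd_mult_iff)
    qed (use Suc.prems in auto)
    then show ?thesis using s Suc.prems(3) by simp
  qed simp
qed

lemma poly_taylor1:
  fixes P :: "int poly"
  shows "\<exists>R. poly P (s + h) = poly P s + h * poly (pderiv P) s + h\<^sup>2 * R"
proof (induction P)
  case (pCons a P)
  then obtain R where R: "poly P (s + h) = poly P s + h * poly (pderiv P) s + h\<^sup>2 * R" by blast
  have "poly (pCons a P) (s + h) = poly (pCons a P) s + h * poly (pderiv (pCons a P)) s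
      + h\<^sup>2 * (poly (pderiv P) s + (s + h) * R)"
    by (simp only: poly_pCons R pderiv_pCons poly_add) (simp add: algebra_simps power2_eq_square)
  then show ?case by blast
qed simp

lemma dvd_poly_mod_iff:
  fixes P :: "int poly"
  shows "m dvd poly P (r mod m) \<longleftrightarrow> m dvd poly P r"
proof -
  obtain R where "poly P (r mod m + m * (r div m)) = poly P (r mod m)
      + m * (r div m) * poly (pderiv P) (r mod m) + (m * (r div m))\<^sup>2 * R"
    using poly_taylor1 by blast
  then have "poly P r = poly P (r mod m)
      + m * ((r div m) * poly (pderiv P) (r mod m) + m * (r div m)\<^sup>2 * R)"
    by (simp add: algebra_simps power2_eq_square)
  then show ?thesis by (simp add: dvd_add_left_iff)
qed

definition roots_mod :: "int poly \<Rightarrow> int \<Rightarrow> int set" where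
  "roots_mod P g = {r \<in> {0..<g}. g dvd poly P r}"

lemma finite_roots_mod [simp]: "finite (roots_mod P g)"
  by (rule finite_subset[of _ "{0..<g}"]) (auto simp: roots_mod_def)

text \<open>This is the uniqueness half of Hensel's lemma: if two roots modulo \<open>p ^ k\<close>
  agree modulo \<open>p\<close>, Taylor expansion writes the difference of the values as
  \<open>r - s\<close> times a unit modulo \<open>p\<close>, so the roots agree modulo
  \<open>p ^ k\<close>. Reduction modulo \<open>p\<close> is thus injective on the roots.\<close>

lemma card_roots_mod_prime_power_le:
  assumes p: "prime p" and "lead_coeff P = 1" and k: "k > 0"
    and simple: "\<And>r. p dvd poly P r \<Longrightarrow> \<not> p dvd poly (pderiv P) r"
  shows "card (roots_mod P (p ^ k)) \<le> degree P"
proof (rule card_incongruent_roots_le[OF p order_refl])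
  show "\<not> p dvd lead_coeff P" using assms(2) not_prime_unit[of p] p by auto
  have pp: "p dvd p ^ k" using k by simp
  show root: "p dvd poly P r" if "r \<in> roots_mod P (p ^ k)" for r
    using that pp unfolding roots_mod_def by (auto intro: dvd_trans)
  show "inj_on (\<lambda>r. r mod p) (roots_mod P (p ^ k))"
  proof (rule inj_onI)
    fix r s assume r: "r \<in> roots_mod P (p ^ k)" and s: "s \<in> roots_mod P (p ^ k)" and "r mod p = s mod p"
    then have rs: "p dvd r - s" by (simp add: mod_eq_dvd_iff)
    obtain R where "poly P (s + (r - s)) = poly P s + (r - s) * poly (pderiv P) s + (r - s)\<^sup>2 * R"
      using poly_taylor1 by blast
    then have "poly P r - poly P s = (r - s) * (poly (pderiv P) s + (r - s) * R)"
      by (simp add: algebra_simps power2_eq_square)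
    moreover have "p ^ k dvd poly P r - poly P s" using r s by (simp add: roots_mod_def)
    ultimately have "p ^ k dvd (r - s) * (poly (pderiv P) s + (r - s) * R)" by simp
    moreover have "\<not> p dvd poly (pderiv P) s + (r - s) * R"
      using simple[OF root[OF s]] rs by (simp add: dvd_add_left_iff)
    then have "coprime (p ^ k) (poly (pderiv P) s + (r - s) * R)"
      using p by (simp add: prime_imp_coprime)
    ultimately have "p ^ k dvd r - s" by (simp add: coprime_dvd_mult_left_iff)
    then have "r mod p ^ k = s mod p ^ k" by (simp add: mod_eq_dvd_iff)
    then show "r = s" using r s by (simp add: roots_mod_def)
  qed
qed simp

lemma card_roots_mod_mult_le:
  assumes "coprime g h" and "g > 0" and "h > 0"
  shows "card (roots_mod P (g * h)) \<le> card (roots_mod P g) * card (roots_mod P h)"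
proof -
  have "card (roots_mod P (g * h)) \<le> card (roots_mod P g \<times> roots_mod P h)"
  proof (rule card_inj_on_le)
    show "inj_on (\<lambda>r. (r mod g, r mod h)) (roots_mod P (g * h))"
    proof (rule inj_onI)
      fix r s assume rs: "r \<in> roots_mod P (g * h)" "s \<in> roots_mod P (g * h)"
        and "(r mod g, r mod h) = (s mod g, s mod h)"
      then have "g dvd r - s" "h dvd r - s" by (auto simp: mod_eq_dvd_iff)
      then have "r mod (g * h) = s mod (g * h)" using assms(1) by (simp add: divides_mult mod_eq_dvd_iff)
      then show "r = s" using rs by (simp add: roots_mod_def)
    qed
    show "(\<lambda>r. (r mod g, r mod h)) ` roots_mod P (g * h) \<subseteq> roots_mod P g \<times> roots_mod P h"
      using assms by (auto simp: roots_mod_def dvd_poly_mod_iff intro: dvd_mult_left dvd_mult_right)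
  qed simp
  then show ?thesis by (simp add: card_cartesian_product)
qed

lemma card_roots_mod_prod_le:
  assumes "finite T" and "\<And>p. p \<in> T \<Longrightarrow> prime p" and "\<And>p. p \<in> T \<Longrightarrow> e p > 0"
    and "lead_coeff P = 1"
    and "\<And>p r. p \<in> T \<Longrightarrow> p dvd poly P r \<Longrightarrow> \<not> p dvd poly (pderiv P) r"
  shows "card (roots_mod P (\<Prod>p\<in>T. p ^ e p)) \<le> degree P ^ card T"
  using assms(1-3,5)
proof (induction T)
  case empty
  have "card (roots_mod P 1) \<le> card {0..<1::int}" by (rule card_mono) (auto simp: roots_mod_def)
  then show ?case by simp
next
  case (insert p T)
  have "coprime (p ^ e p) (\<Prod>p\<in>T. p ^ e p)"
    using insert by (intro prod_coprime_right) (auto intro!: primes_coprime)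
  moreover have "p ^ e p > 0" "(\<Prod>p\<in>T. p ^ e p) > 0"
    using insert.prems by (auto intro!: prod_pos simp: prime_gt_0_int)
  ultimately have "card (roots_mod P (p ^ e p * (\<Prod>p\<in>T. p ^ e p)))
      \<le> card (roots_mod P (p ^ e p)) * card (roots_mod P (\<Prod>p\<in>T. p ^ e p))"
    by (intro card_roots_mod_mult_le)
  also have "\<dots> \<le> degree P * degree P ^ card T"
    using insert.prems insert.IH assms(4) by (intro mult_mono card_roots_mod_prime_power_le) auto
  finally show ?case using insert by simp
qed

section \<open>Lucas sequences with negative second parameter\<close>

lemma lucas_U_neg_pos:
  assumes "a > 0" and "b > 0"
  shows "lucas_U a (- b) (Suc k) > 0"
  using assms by (induction k rule: induct_nat_012) (auto intro: add_pos_pos)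

lemma lucas_U_neg_nonneg:
  assumes "a > 0" and "b > 0"
  shows "lucas_U a (- b) k \<ge> 0"
  using lucas_U_neg_pos[OF assms] by (cases k) (auto intro: less_imp_le)

lemma lucas_U_neg_mono:
  assumes "0 < a" "a \<le> a'" "0 < b" "b \<le> b'"
  shows "lucas_U a (- b) k \<le> lucas_U a' (- b') k"
proof (induction k rule: induct_nat_012)
  case (ge2 k)
  have "a * lucas_U a (- b) (Suc k) + b * lucas_U a (- b) k
      \<le> a' * lucas_U a' (- b') (Suc k) + b' * lucas_U a' (- b') k"
    using assms ge2 by (intro add_mono mult_mono lucas_U_neg_nonneg) auto
  then show ?case by simp
qed simp_all

lemma lucas_U_neg_strict_mono:
  assumes "0 < a" "a < a'" "0 < b" "b \<le> b'"
  shows "lucas_U a (- b) (k + 2) < lucas_U a' (- b') (k + 2)"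
proof -
  have "a * lucas_U a (- b) (Suc k) < a' * lucas_U a (- b) (Suc k)"
    using assms lucas_U_neg_pos[of a b k] by (intro mult_strict_right_mono) auto
  also have "\<dots> \<le> a' * lucas_U a' (- b') (Suc k)"
    using assms by (intro mult_left_mono lucas_U_neg_mono) auto
  finally have "a * lucas_U a (- b) (Suc k) < a' * lucas_U a' (- b') (Suc k)" .
  moreover have "b * lucas_U a (- b) k \<le> b' * lucas_U a' (- b') k"
    using assms by (intro mult_mono lucas_U_neg_mono lucas_U_neg_nonneg) auto
  ultimately show ?thesis by simp
qed

text \<open>Pairs with the same ratio of \<open>a\<^sup>2\<close> to \<open>b\<close> are ordered
  alike in both coordinates, and U_k strictly increases along this order.\<close>

lemma lucas_U_neg_eq_imp_le:
  assumes "a > 0" "b > 0" "a' > 0" "b' > 0" and "k \<ge> 2"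
    and eq: "lucas_U a (- b) k = lucas_U a' (- b') k" and ratio: "a\<^sup>2 * b' = a'\<^sup>2 * b"
  shows "a' \<le> a"
proof (rule ccontr)
  assume "\<not> a' \<le> a"
  then have aa: "a < a'" by simp
  then have "a\<^sup>2 < a'\<^sup>2" using assms(1) by (simp add: power_strict_mono)
  then have "a\<^sup>2 * b < a\<^sup>2 * b'" unfolding ratio using assms by simp
  then have "b \<le> b'" using assms(1) by simp
  then show False
    using lucas_U_neg_strict_mono[OF \<open>a > 0\<close> aa \<open>b > 0\<close>, of b' "k - 2"] \<open>k \<ge> 2\<close> eq
    by (simp del: lucas_U.simps add_2_eq_Suc')
qed

lemma lucas_U_neg_upper:
  assumes "0 < a" "a \<le> 3 * X" "0 < b" "b \<le> X\<^sup>2"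
  shows "lucas_U a (- b) (Suc k) \<le> (4 * X) ^ k"
proof (induction k rule: induct_nat_012)
  case 0
  show ?case by simp
next
  case 1
  show ?case using assms by simp
next
  case (ge2 k)
  have X: "X > 0" using assms by simp
  have "lucas_U a (- b) (Suc (Suc (Suc k))) = a * lucas_U a (- b) (Suc (Suc k)) + b * lucas_U a (- b) (Suc k)"
    by simp
  also have "\<dots> \<le> 3 * X * (4 * X) ^ Suc k + X\<^sup>2 * (4 * X) ^ k"
    using assms ge2 X by (intro add_mono mult_mono lucas_U_neg_nonneg) auto
  also have "\<dots> = 13 * (X * (X * (4 * X) ^ k))"
    by (simp add: algebra_simps power2_eq_square)
  also have "\<dots> \<le> 16 * (X * (X * (4 * X) ^ k))" using X by simp
  also have "\<dots> = (4 * X) ^ Suc (Suc k)" by simp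
  finally show ?case .
qed

lemma lucas_U_neg_lower:
  assumes "a > 0" and "b > 0"
  shows "a ^ k \<le> lucas_U a (- b) (Suc k)"
proof (induction k rule: induct_nat_012)
  case (ge2 k)
  have "a ^ Suc (Suc k) + 0 \<le> a * lucas_U a (- b) (Suc (Suc k)) + b * lucas_U a (- b) (Suc k)"
    using assms ge2 lucas_U_neg_nonneg[OF assms, of "Suc k"] by (intro add_mono) auto
  then show ?case by simp
qed simp_all

text \<open>A root of unity as quotient would give both roots the same absolute value. As their
  product is the negative number \<open>- b\<close>, one root would be minus the conjugate of the
  other, making their sum \<open>a\<close> purely imaginary.\<close>

lemma nondegenerate_neg:
  assumes "a > 0" and "b > 0"
  shows "nondegenerate a (- b)"
  unfolding nondegenerate_def
proof (intro conjI allI impI notI)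
  show "a * - b = 0 \<Longrightarrow> False" using assms by simp
  fix \<alpha> \<beta> assume "char_roots a (- b) \<alpha> \<beta>" and "root_of_unity (\<alpha> / \<beta>)"
  then have *: "- of_int b = \<beta> * \<alpha>" "- of_int a = - \<beta> - \<alpha>"
    by (auto simp: char_roots_def)
  have prod: "\<alpha> * \<beta> = - of_int b" using *(1) by (simp add: mult.commute)
  have "\<alpha> + \<beta> = - (- of_int a)" unfolding *(2) by simp
  then have sum: "\<alpha> + \<beta> = of_int a" by simp
  obtain k where k: "k > 0" "(\<alpha> / \<beta>) ^ k = 1"
    using \<open>root_of_unity _\<close> by (auto simp: root_of_unity_def)
  then have "cmod (\<alpha> / \<beta>) = 1" using power_eq_1_iff[OF k(2)] by simp
  then have nn: "cmod \<alpha> = cmod \<beta>" by (auto simp: norm_divide divide_eq_1_iff)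
  have "cmod \<alpha> * cmod \<beta> = real_of_int b"
    using assms prod by (metis norm_mult norm_minus_cancel norm_of_int abs_of_pos of_int_abs)
  then have "\<alpha> * cnj \<alpha> = of_int b"
    using nn by (simp add: complex_norm_square[symmetric] power2_eq_square flip: of_real_mult)
  then have "\<alpha> * (\<beta> + cnj \<alpha>) = 0" using prod by (simp add: distrib_left)
  moreover have "\<alpha> \<noteq> 0" using prod assms by auto
  ultimately have "\<beta> = - cnj \<alpha>" by (simp add: eq_neg_iff_add_eq_0)
  then have "Re (of_int a) = 0" unfolding sum[symmetric] by simp
  then show False using assms by simp
qed

section \<open>Parameters with a common value\<close>

text \<open>Pigeonhole: cut \<open>W\<close> into \<open>Suc q\<close> blocks of at most
  \<open>s\<close> elements. If every block had product below \<open>Y\<close>, the whole product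
  would be below \<open>Y ^ Suc q\<close>. The induction removes one block at a time.\<close>

lemma prod_large_subset:
  fixes f :: "'a \<Rightarrow> int"
  assumes "finite W" and "\<And>x. x \<in> W \<Longrightarrow> f x > 0" and "Y > 0"
    and "card W \<le> Suc q * s" and "Y ^ Suc q \<le> prod f W"
  shows "\<exists>T\<subseteq>W. card T \<le> s \<and> Y \<le> prod f T"
  using assms
proof (induction q arbitrary: W)
  case 0
  then show ?case by auto
next
  case (Suc q)
  obtain T where T: "T \<subseteq> W" "card T = min s (card W)"
    by (metis obtain_subset_with_card_n min.cobounded2)
  show ?case
  proof (cases "Y \<le> prod f T")
    case False
    have fin: "finite T" using T Suc.prems(1) finite_subset by blast
    have split: "prod f W = prod f T * prod f (W - T)"
      using T Suc.prems(1) by (metis mult.commute prod.subset_diff)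
    have "Y ^ Suc q \<le> prod f (W - T)"
    proof (rule ccontr)
      assume "\<not> Y ^ Suc q \<le> prod f (W - T)"
      moreover have "0 \<le> prod f (W - T)" using Suc.prems(2) by (intro prod_nonneg) (auto intro: less_imp_le)
      ultimately have "prod f T * prod f (W - T) \<le> Y * prod f (W - T)"
        using False by (intro mult_right_mono) auto
      also have "\<dots> < Y * Y ^ Suc q"
        using Suc.prems(3) \<open>\<not> Y ^ Suc q \<le> prod f (W - T)\<close> by (intro mult_strict_left_mono) auto
      finally show False using Suc.prems(5) split by simp
    qed
    moreover have "card (W - T) \<le> Suc q * s"
      using T fin Suc.prems(4) by (auto simp: card_Diff_subset)
    ultimately have "\<exists>T'\<subseteq>W - T. card T' \<le> s \<and> Y \<le> prod f T'"
      using Suc.prems by (intro Suc.IH) auto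
    then show ?thesis by blast
  qed (use T in auto)
qed

lemma card_lucas_fibre_le:
  fixes S :: "(int \<times> int) set"
  assumes n: "n \<ge> 5" and X: "X > 0"
    and cop: "coprime x (2 * int n)"
    and S: "\<And>a b. (a, b) \<in> S \<Longrightarrow> lucas_U a (- b) n = x \<and> coprime a b \<and> X \<le> a \<and> 0 < b"
    and small: "\<And>a b a' b'. (a, b) \<in> S \<Longrightarrow> (a', b') \<in> S \<Longrightarrow> a\<^sup>2 * b' < X ^ 4"
  shows "card S \<le> n * 8 ^ card (prime_factors x)"
proof (cases "S = {}")
  case False
  then obtain a0 b0 where ab0: "(a0, b0) \<in> S" by auto
  define W where "W = prime_factors x"
  define e where "e p = multiplicity p x" for p
  \<comment> \<open>The number of blocks is \<open>Suc q\<close>, which is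
    \<open>(n - 1) div 4\<close>; the added 1 in \<open>s\<close> lets the blocks exhaust
    \<open>W\<close>.\<close>
  define q where "q = (n - 1) div 4 - 1"
  define s where "s = card W div Suc q + 1"
  have q: "4 * Suc q \<le> n - 1" "n \<le> 4 * Suc q + 4" using n by (auto simp: q_def)
  have "X ^ (4 * Suc q) \<le> X ^ (n - 1)" using X q by (intro power_increasing) auto
  also have "\<dots> \<le> a0 ^ (n - 1)" using S[OF ab0] X by (intro power_mono) auto
  also have "\<dots> \<le> x" using lucas_U_neg_lower[of a0 b0 "n - 1"] S[OF ab0] X n by auto
  finally have x: "(X ^ 4) ^ Suc q \<le> x" by (simp only: power_mult)
  moreover have "(X ^ 4) ^ Suc q > 0" using X by simp
  ultimately have x0: "x > 0" by linarith
  have prime: "prime p" if "p \<in> W" for p using that by (simp add: W_def in_prime_factors_iff)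
  have prodW: "(\<Prod>p\<in>W. p ^ e p) = x"
    using x0 prod_prime_factors[of x] by (simp add: W_def e_def)
  have "card W \<le> Suc q * s"
    unfolding s_def by (metis Suc_eq_plus1 dividend_less_times_div less_imp_le mult_Suc_right add.commute zero_less_Suc distrib_left mult.right_neutral)
  then obtain T where T: "T \<subseteq> W" "card T \<le> s" "X ^ 4 \<le> (\<Prod>p\<in>T. p ^ e p)"
    using prod_large_subset[of W "\<lambda>p. p ^ e p" "X ^ 4" q s] x X prime prodW
    by (auto simp: W_def prime_gt_0_int)
  define g where "g = (\<Prod>p\<in>T. p ^ e p)"
  have "X ^ 4 > 0" using X by simp
  then have g0: "g > 0" using T(3) unfolding g_def by linarith
  have "g dvd x" unfolding g_def prodW[symmetric] using T by (intro prod_dvd_prod_subset) (auto simp: W_def)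
  \<comment> \<open>Modulo \<open>b\<close>, \<open>x\<close> is congruent to
    \<open>a ^ (n - 1)\<close>, which is coprime to \<open>b\<close>.\<close>
  have gb: "coprime g b" if "(a, b) \<in> S" for a b
  proof -
    have "b dvd x - a ^ (n - 1)" using lucas_U_mod_B[of "- b" a "n - 1"] S[OF that] n by simp
    then have "gcd b x = gcd b (a ^ (n - 1))" by (metis gcd.commute gcd_red_int mod_eq_dvd_iff)
    moreover have "coprime b (a ^ (n - 1))" using S[OF that] by (simp add: coprime_commute)
    ultimately have "coprime b x" by (simp add: coprime_iff_gcd_eq_1)
    then show ?thesis using \<open>g dvd x\<close> by (meson coprime_commute coprime_divisors dvd_refl)
  qed
  \<comment> \<open>With \<open>v\<close> an inverse of \<open>b\<close> modulo \<open>g\<close>,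
    the witness is \<open>- a\<^sup>2 * v - 2\<close>.\<close>
  have "\<exists>c. g dvd a\<^sup>2 - (c + 2) * (- b)" if ab: "(a, b) \<in> S" for a b
  proof -
    obtain u v where "u * g + v * b = 1" using gb[OF ab] bezout_int[of g b] by auto
    then have vb: "v * b = 1 - u * g" by simp
    have "a\<^sup>2 - ((- a\<^sup>2 * v - 2) + 2) * (- b) = a\<^sup>2 - a\<^sup>2 * (v * b)" by (simp add: algebra_simps)
    also have "\<dots> = g * (a\<^sup>2 * u)" unfolding vb by (simp add: algebra_simps)
    finally show ?thesis by (metis dvd_triv_left)
  qed
  then obtain c where c: "\<And>a b. (a, b) \<in> S \<Longrightarrow> g dvd a\<^sup>2 - (c a b + 2) * (- b)" by metis
  have "card S \<le> card (roots_mod (class_poly n) g)"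
  proof (rule card_inj_on_le)
    show "inj_on (\<lambda>(a, b). c a b mod g) S"
    proof (rule inj_onI, clarify)
      fix a b a' b' assume ab: "(a, b) \<in> S" and ab': "(a', b') \<in> S" and "c a b mod g = c a' b' mod g"
      then have "g dvd c a b - c a' b'" by (simp add: mod_eq_dvd_iff)
      \<comment> \<open>Cross-multiplication eliminates the common \<open>c\<close>. Both resulting
        products are positive and below \<open>g\<close>, so their congruence is an
        equality.\<close>
      then have "g dvd b' * (a\<^sup>2 - (c a b + 2) * (- b)) - b * (a'\<^sup>2 - (c a' b' + 2) * (- b'))
          - (c a b - c a' b') * (b * b')"
        by (rule dvd_diff[OF dvd_diff[OF dvd_mult[OF c[OF ab]] dvd_mult[OF c[OF ab']]] dvd_mult2])
      also have "\<dots> = a\<^sup>2 * b' - a'\<^sup>2 * b" by (simp add: algebra_simps)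
      finally have "a\<^sup>2 * b' mod g = a'\<^sup>2 * b mod g" by (simp add: mod_eq_dvd_iff)
      moreover have "a\<^sup>2 * b' < g" "a'\<^sup>2 * b < g"
        using small[OF ab ab'] small[OF ab' ab] T(3) unfolding g_def by linarith+
      moreover have pos: "a > 0" "b > 0" "a' > 0" "b' > 0" using S[OF ab] S[OF ab'] X by auto
      ultimately have ratio: "a\<^sup>2 * b' = a'\<^sup>2 * b" by simp
      have "a = a'"
        using lucas_U_neg_eq_imp_le[of a b a' b' n] lucas_U_neg_eq_imp_le[of a' b' a b n]
          pos ratio S[OF ab] S[OF ab'] n by simp
      with ratio pos show "a = a' \<and> b = b'" by simp
    qed
    show "(\<lambda>(a, b). c a b mod g) ` S \<subseteq> roots_mod (class_poly n) g"
    proof clarify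
      fix a b assume ab: "(a, b) \<in> S"
      have "g dvd poly (class_poly n) (c a b)"
        by (rule dvd_class_poly[OF _ c[OF ab]]) (use S[OF ab] gb[OF ab] \<open>g dvd x\<close> in auto)
      then show "c a b mod g \<in> roots_mod (class_poly n) g"
        using g0 by (simp add: roots_mod_def dvd_poly_mod_iff)
    qed
  qed simp
  also have "\<dots> \<le> degree (class_poly n) ^ card T"
    unfolding g_def
  proof (rule card_roots_mod_prod_le)
    show "finite T" using T(1) by (rule finite_subset) (simp add: W_def)
    show "prime p" if "p \<in> T" for p using that T(1) prime by blast
    show "e p > 0" if "p \<in> T" for p
      using that T(1) x0 by (auto simp: W_def e_def prime_factors_multiplicity)
    show "lead_coeff (class_poly n) = 1" using n class_poly_monic by simp
    fix p r assume p: "p \<in> T" and "p dvd poly (class_poly n) r"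
    have "p dvd x" using p T(1) by (auto simp: W_def)
    then have "\<not> p dvd 2 * int n"
      using cop p T(1) prime not_prime_unit by (metis coprime_common_divisor subsetD)
    then show "\<not> p dvd poly (pderiv (class_poly n)) r"
      using class_poly_simple_root p T(1) prime \<open>p dvd poly _ r\<close> by blast
  qed
  also have "\<dots> \<le> n ^ s"
    using T(2) n class_poly_monic[of n] by (simp add: power_increasing)
  also have "\<dots> = n * n ^ (card W div Suc q)" by (simp add: s_def)
  also have "\<dots> \<le> n * (8 ^ Suc q) ^ (card W div Suc q)"
  proof -
    \<comment> \<open>This is where the base 8 comes from: at \<open>q = 0\<close> both sides equal
      8, and \<open>n = 8\<close> attains the bound on \<open>n\<close>.\<close>
    have "4 * Suc q + 4 \<le> 8 ^ Suc q" by (induction q) auto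
    then show ?thesis using q by (intro mult_left_mono power_mono) auto
  qed
  also have "\<dots> \<le> n * 8 ^ card W"
    unfolding power_mult[symmetric]
    by (intro mult_left_mono power_increasing times_div_less_eq_dividend) auto
  finally show ?thesis by (simp add: W_def)
qed simp

section \<open>The number of prime factors\<close>

text \<open>There are at most \<open>z\<close> prime factors below \<open>z\<close>. The others are
  each at least \<open>z\<close> and have a product dividing \<open>x\<close>, which bounds their
  number by \<open>ln x / ln z\<close>.\<close>

lemma card_prime_factors_le:
  fixes x :: int and z :: real
  assumes "x > 0" and "z > 1"
  shows "real (card (prime_factors x)) \<le> z + ln x / ln z"
proof -
  define L H where "L = {p \<in> prime_factors x. p < z}" and "H = {p \<in> prime_factors x. \<not> p < z}"
  have "L \<subseteq> {1..\<lceil>z\<rceil> - 1}"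
    by (auto simp: L_def less_ceiling_iff in_prime_factors_iff dest: prime_gt_0_int)
  then have "card L \<le> card {1..\<lceil>z\<rceil> - 1}" by (intro card_mono) auto
  then have "real (card L) \<le> real (card {1..\<lceil>z\<rceil> - 1})" by (simp only: of_nat_le_iff)
  also have "\<dots> \<le> z" using assms by simp
  finally have L: "real (card L) \<le> z" .
  have "z ^ card H = (\<Prod>p\<in>H. z)" by simp
  also have "\<dots> \<le> (\<Prod>p\<in>H. real_of_int p)"
    using assms by (intro prod_mono) (auto simp: H_def)
  also have "\<dots> = real_of_int (\<Prod>H)" by simp
  also have "\<dots> \<le> real_of_int x"
  proof -
    have "\<Prod>H dvd \<Prod>(prime_factors x)" by (rule prod_dvd_prod_subset) (auto simp: H_def)
    also have "\<dots> dvd (\<Prod>p\<in>prime_factors x. p ^ multiplicity p x)"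
      by (rule prod_dvd_prod) (auto simp: prime_factors_multiplicity intro: dvd_power)
    also have "\<dots> = x" using assms by (subst prod_prime_factors) auto
    finally show ?thesis using assms zdvd_imp_le by (simp del: of_int_prod)
  qed
  finally have "ln (z ^ card H) \<le> ln x" using assms by (subst ln_le_cancel_iff) auto
  then have H: "real (card H) \<le> ln x / ln z"
    using assms by (simp add: ln_realpow field_simps)
  have "prime_factors x = L \<union> H" "L \<inter> H = {}" by (auto simp: L_def H_def)
  then have "card (prime_factors x) = card L + card H"
    by (metis card_Un_disjoint finite_Un finite_set_mset)
  then show ?thesis using L H by simp
qed

lemma eventually_pow8_card_prime_factors_le:
  "\<forall>\<^sub>F y::real in at_top. \<forall>x::int. 0 < x \<longrightarrow> x \<le> y \<longrightarrow>
     8 ^ card (prime_factors x) \<le> y powr (4 / ln (ln y))"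
proof -
  \<comment> \<open>The cut \<open>z = ln y powr (2/3)\<close> is negligible against
    \<open>ln y / ln (ln y)\<close>, while \<open>ln z\<close> is \<open>2/3 * ln (ln y)\<close>.
    Since \<open>ln 8\<close> is at most 21/10, the leading constant is at most 3.15, below
    4.\<close>
  have ev: "\<forall>\<^sub>F y::real in at_top.
    21 / 10 * (ln y powr (2/3) + ln y / ln (ln y powr (2/3))) \<le> 4 / ln (ln y) * ln y"
    by real_asymp
  have ev2: "\<forall>\<^sub>F y::real in at_top. ln y powr (2/3) > 1" by real_asymp
  have ev3: "\<forall>\<^sub>F y::real in at_top. ln y > 1" by real_asymp
  show ?thesis using ev ev2 ev3 eventually_gt_at_top[of 1]
  proof eventually_elim
    case (elim y)
    show ?case
    proof (intro allI impI)
      fix x :: int assume x: "0 < x" "x \<le> y"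
      let ?z = "ln y powr (2/3)" and ?w = "card (prime_factors x)"
      have "ln x / ln ?z \<le> ln y / ln ?z" using x elim by (intro divide_right_mono) auto
      then have w: "?w \<le> ?z + ln y / ln ?z"
        using card_prime_factors_le[OF x(1) elim(2)] by linarith
      have "ln (8::real) = ln (2 ^ 3)" by simp
      also have "\<dots> = 3 * ln 2" by (subst ln_realpow) auto
      also have "\<dots> \<le> 21 / 10" using ln2_le_25_over_36 by simp
      finally have "ln 8 * ?w \<le> 21 / 10 * (?z + ln y / ln ?z)" using w by (intro mult_mono) auto
      also note elim(1)
      finally have "exp (ln 8 * ?w) \<le> exp (4 / ln (ln y) * ln y)" by simp
      moreover have "exp (ln 8 * ?w) = (8::real) ^ ?w" by (simp add: exp_of_nat2_mult)
      ultimately show "8 ^ ?w \<le> y powr (4 / ln (ln y))" using elim by (simp add: powr_def)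
    qed
  qed
qed

section \<open>Coprime parameters\<close>

lemma sum_inverse_squares_le:
  assumes "m \<ge> 10"
  shows "(\<Sum>q=11..m. 1 / (real q)\<^sup>2) \<le> 1 / 10 - 1 / m"
  using assms
proof (induction m rule: dec_induct)
  case (step m)
  have "1 / (real (Suc m))\<^sup>2 \<le> 1 / (real m * real (Suc m))"
    unfolding power2_eq_square using step by (intro divide_left_mono mult_right_mono) auto
  also have "\<dots> = 1 / m - 1 / Suc m" using step by (simp add: field_simps)
  finally have "1 / (real (Suc m))\<^sup>2 \<le> 1 / m - 1 / Suc m" .
  then show ?case using step by simp
qed simp

lemma harm_le_ln: "m \<ge> 1 \<Longrightarrow> harm m \<le> 1 + ln (real m)"
  using decseqD[OF decseq_harm_diff_ln, of 0 "m - 1"] by (simp add: harm_expand)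

text \<open>As \<open>M\<close> is invertible modulo \<open>q\<close>, the solutions lie in one
  residue class, with at most one in each block of \<open>q\<close> consecutive numbers.\<close>

lemma card_congruence_le:
  fixes q M T :: nat
  assumes "coprime q M" and "q > 0"
  shows "real (card {s \<in> {1..T}. q dvd M * s + 1}) \<le> real T / q + 1"
proof -
  have "card {s \<in> {1..T}. q dvd M * s + 1} \<le> card {0..T div q}"
  proof (rule card_inj_on_le)
    show "inj_on (\<lambda>s. s div q) {s \<in> {1..T}. q dvd M * s + 1}"
    proof (rule inj_onI)
      fix s s' assume s: "s \<in> {s \<in> {1..T}. q dvd M * s + 1}" "s' \<in> {s \<in> {1..T}. q dvd M * s + 1}"
        and d: "s div q = s' div q"
      have "int q dvd int (M * s + 1) - int (M * s' + 1)"
        using s by (intro dvd_diff) (simp_all only: of_nat_dvd_iff mem_Collect_eq)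
      also have "int (M * s + 1) - int (M * s' + 1) = int M * (int s - int s')" by (simp add: algebra_simps)
      finally have "int q dvd int s - int s'"
        using assms(1) by (simp add: coprime_dvd_mult_right_iff)
      then have "s mod q = s' mod q"
        by (metis mod_eq_dvd_iff nat_int of_nat_mod nat_int)
      then show "s = s'" using d by (metis div_mult_mod_eq)
    qed
  qed (auto simp: div_le_mono)
  then have "real (card {s \<in> {1..T}. q dvd M * s + 1}) \<le> real (T div q) + 1" by simp
  also have "\<dots> \<le> real T / q + 1" using of_nat_div_le_of_nat[of T q] by simp
  finally show ?thesis .
qed

lemma card_multiples_le:
  fixes q T :: nat
  assumes "q > 0"
  shows "real (card {t \<in> {1..T}. q dvd t}) \<le> real T / q"
proof -
  have "card {t \<in> {1..T}. q dvd t} \<le> card {1..T div q}"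
    using assms by (intro card_inj_on_le[of "\<lambda>t. t div q"])
      (auto intro!: inj_onI simp: div_le_mono dvd_div_eq_iff dest: dvd_imp_le simp: Suc_le_eq div_greater_zero_iff)
  then have "real (card {t \<in> {1..T}. q dvd t}) \<le> real (T div q)" by simp
  also have "\<dots> \<le> real T / q" by (rule of_nat_div_le_of_nat)
  finally show ?thesis .
qed

text \<open>A point \<open>(s, t)\<close> stands for the pair \<open>a = M * s + 1\<close>,
  \<open>b = M * t\<close>. The box has \<open>Z ^ 3\<close> points and keeps \<open>a\<close>
  between \<open>M * Z\<close> and \<open>3 * M * Z\<close>.\<close>

definition coprime_params :: "nat \<Rightarrow> nat \<Rightarrow> (nat \<times> nat) set" where
  "coprime_params M Z = {(s, t) \<in> {Z<..2 * Z} \<times> {1..Z\<^sup>2}. coprime (M * s + 1) (M * t)}"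

text \<open>A union bound over common divisors \<open>q\<close>. A common prime factor cannot divide
  \<open>M\<close>, hence exceeds 10 and divides \<open>t\<close>. The excluded pairs number at most
  \<open>(2/10 + 3/10) * Z ^ 3\<close>: the first share comes from the sum of \<open>1/q^2\<close>,
  the second from the harmonic sum.\<close>

lemma card_coprime_params_ge:
  assumes M: "\<And>p. prime p \<Longrightarrow> p \<le> 10 \<Longrightarrow> p dvd M"
    and Z: "Z \<ge> 1" "(real Z)\<^sup>2 * (1 + ln ((real Z)\<^sup>2)) \<le> 3 / 10 * real Z ^ 3"
  shows "real (card (coprime_params M Z)) \<ge> real Z ^ 3 / 2"
proof -
  define Q where "Q = {q \<in> {11..Z\<^sup>2}. coprime q M}"
  define A where "A q = {s \<in> {1..2 * Z}. q dvd M * s + 1}" for q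
  define B where "B q = {t \<in> {1..Z\<^sup>2}. q dvd t}" for q
  define R where "R = (\<Union>q\<in>Q. A q \<times> B q)"
  have fin: "finite Q" "finite (A q)" "finite (B q)" for q by (auto simp: Q_def A_def B_def)
  have "{Z<..2 * Z} \<times> {1..Z\<^sup>2} \<subseteq> coprime_params M Z \<union> R"
  proof clarify
    fix s t assume s: "s \<in> {Z<..2 * Z}" and t: "t \<in> {1..Z\<^sup>2}" and "(s, t) \<notin> R"
    have "coprime (M * s + 1) (M * t)"
    proof (rule ccontr)
      assume "\<not> coprime (M * s + 1) (M * t)"
      then obtain d where d: "d dvd M * s + 1" "d dvd M * t" "\<not> is_unit d"
        by (rule not_coprimeE)
      then obtain q where "prime q" "q dvd d" using prime_factor_nat[of d] by auto
      with d have q: "prime q" "q dvd M * s + 1" "q dvd M * t" by (auto intro: dvd_trans)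
      have nM: "\<not> q dvd M"
        using q(1,2) by (metis dvd_add_right_iff dvd_mult2 not_prime_unit)
      then have "q dvd t" "q > 10" "coprime q M"
        using q M by (auto simp: prime_dvd_mult_iff prime_imp_coprime not_le[symmetric])
      moreover then have "q \<le> Z\<^sup>2" using t by (auto dest: dvd_imp_le)
      ultimately have "(s, t) \<in> R" using s t q
        unfolding R_def Q_def A_def B_def by (intro UN_I[of q]) auto
      then show False using \<open>(s, t) \<notin> R\<close> by simp
    qed
    then show "(s, t) \<in> coprime_params M Z" using s t by (simp add: coprime_params_def)
  qed
  moreover have "finite (coprime_params M Z)"
    by (rule finite_subset[of _ "{Z<..2 * Z} \<times> {1..Z\<^sup>2}"]) (auto simp: coprime_params_def)
  ultimately have "card ({Z<..2 * Z} \<times> {1..Z\<^sup>2}) \<le> card (coprime_params M Z \<union> R)"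
    using fin by (intro card_mono) (auto simp: R_def)
  also have "\<dots> \<le> card (coprime_params M Z) + card R" by (rule card_Un_le)
  finally have "Z ^ 3 \<le> card (coprime_params M Z) + card R"
    by (simp add: card_cartesian_product power2_eq_square power3_eq_cube)
  then have tot: "real Z ^ 3 \<le> real (card (coprime_params M Z)) + real (card R)"
    by (metis of_nat_add of_nat_le_iff of_nat_power)
  have "card R \<le> (\<Sum>q\<in>Q. card (A q \<times> B q))" unfolding R_def by (rule card_UN_le) (rule fin)
  then have "real (card R) \<le> real (\<Sum>q\<in>Q. card (A q \<times> B q))" by (simp only: of_nat_le_iff)
  also have "\<dots> = (\<Sum>q\<in>Q. real (card (A q)) * real (card (B q)))" by (simp add: card_cartesian_product)
  also have "\<dots> \<le> (\<Sum>q\<in>Q. (real (2 * Z) / q + 1) * (real (Z\<^sup>2) / q))"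
    unfolding A_def B_def
    by (intro sum_mono mult_mono card_congruence_le card_multiples_le) (auto simp: Q_def)
  also have "\<dots> \<le> (\<Sum>q=11..Z\<^sup>2. (real (2 * Z) / q + 1) * (real (Z\<^sup>2) / q))"
    by (intro sum_mono2) (auto simp: Q_def)
  also have "\<dots> = (\<Sum>q=11..Z\<^sup>2. 2 * real Z ^ 3 * (1 / (real q)\<^sup>2) + (real Z)\<^sup>2 * (1 / q))"
    by (intro sum.cong) (auto simp: field_simps power2_eq_square power3_eq_cube)
  also have "\<dots> = 2 * real Z ^ 3 * (\<Sum>q=11..Z\<^sup>2. 1 / (real q)\<^sup>2) + (real Z)\<^sup>2 * (\<Sum>q=11..Z\<^sup>2. 1 / q)"
    by (simp only: sum.distrib sum_distrib_left)
  also have "\<dots> \<le> 2 * real Z ^ 3 * (1 / 10) + (real Z)\<^sup>2 * (1 + ln ((real Z)\<^sup>2))"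
  proof (intro add_mono mult_left_mono)
    show "(\<Sum>q=11..Z\<^sup>2. 1 / (real q)\<^sup>2) \<le> 1 / 10"
    proof (cases "Z\<^sup>2 \<ge> 10")
      case True
      have "1 / 10 - 1 / real (Z\<^sup>2) \<le> 1 / 10" by simp
      then show ?thesis using sum_inverse_squares_le[OF True] by linarith
    qed simp
    have "(\<Sum>q=11..Z\<^sup>2. 1 / real q) \<le> harm (Z\<^sup>2)"
      unfolding harm_def inverse_eq_divide by (intro sum_mono2) auto
    also have "\<dots> \<le> 1 + ln (real (Z\<^sup>2))" using Z by (intro harm_le_ln) (simp add: Suc_le_eq)
    finally show "(\<Sum>q=11..Z\<^sup>2. 1 / real q) \<le> 1 + ln ((real Z)\<^sup>2)" by simp
  qed auto
  also have "\<dots> \<le> real Z ^ 3 / 2" using Z(2) by simp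
  finally show ?thesis using tot by simp
qed

section \<open>Counting values\<close>

lemma card_le_card_image:
  fixes K :: real
  assumes "finite G" and "\<And>y. y \<in> f ` G \<Longrightarrow> real (card {g \<in> G. f g = y}) \<le> K"
  shows "real (card G) \<le> K * real (card (f ` G))"
proof -
  have "card G = (\<Sum>y\<in>f ` G. card {g \<in> G. f g = y})"
    using sum.image_gen[OF assms(1), of "\<lambda>_. 1::nat" f] by simp
  then have "real (card G) = (\<Sum>y\<in>f ` G. real (card {g \<in> G. f g = y}))" by simp
  also have "\<dots> \<le> (\<Sum>y\<in>f ` G. K)" by (intro sum_mono assms(2))
  finally show ?thesis by (simp add: mult.commute)
qed

definition lucas_params :: "nat \<Rightarrow> nat \<Rightarrow> (int \<times> int) set" where
  "lucas_params M Z = (\<lambda>(s, t). (int (M * s + 1), int (M * t))) ` coprime_params M Z"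

lemma card_lucas_params: "M > 0 \<Longrightarrow> card (lucas_params M Z) = card (coprime_params M Z)"
  unfolding lucas_params_def by (intro card_image inj_onI) auto

lemma finite_lucas_params: "finite (lucas_params M Z)"
  unfolding lucas_params_def coprime_params_def
  by (rule finite_imageI, rule finite_subset[of _ "{Z<..2 * Z} \<times> {1..Z\<^sup>2}"]) auto

lemma lucas_paramsD:
  assumes "(a, b) \<in> lucas_params M Z" and "M > 9" and "Z > 0"
  shows "coprime a b" "int M dvd a - 1" "int M dvd b" "0 < b"
    "int (M * Z) \<le> a" "a \<le> 3 * int (M * Z)" "b \<le> int (M * Z) * int Z"
proof -
  obtain s t where st: "(s, t) \<in> coprime_params M Z" and a: "a = int (M * s + 1)" and b: "b = int (M * t)"
    using assms(1) unfolding lucas_params_def by auto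
  from st have s: "Z < s" "s \<le> 2 * Z" and t: "1 \<le> t" "t \<le> Z\<^sup>2"
    and cop: "coprime (M * s + 1) (M * t)"
    unfolding coprime_params_def by simp_all
  show "coprime a b" unfolding a b coprime_int_iff by (rule cop)
  show "int M dvd a - 1" "int M dvd b" unfolding a b by simp_all
  show "0 < b" unfolding b using t(1) assms(2) by simp
  have "M * Z \<le> M * s" using s(1) by simp
  then show "int (M * Z) \<le> a" unfolding a by linarith
  have "M * s \<le> M * (2 * Z)" using s(2) by (rule mult_le_mono2)
  moreover have "0 < M * Z" using assms(2,3) by simp
  ultimately have "M * s + 1 \<le> 3 * (M * Z)" by linarith
  then show "a \<le> 3 * int (M * Z)" unfolding a by linarith
  have "M * t \<le> M * Z * Z" using t(2) by (simp add: power2_eq_square)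
  then show "b \<le> int (M * Z) * int Z" unfolding b by (metis of_nat_le_iff of_nat_mult)
qed

lemma card_lucas_values_ge:
  fixes n M Z :: nat and N :: int and K :: real
  assumes n: "n \<ge> 5" and M: "M > 9" "2 * n dvd M" and Z: "Z > 0"
    and N: "int (4 * M * Z) ^ (n - 1) \<le> N"
    and K: "\<And>x::int. 0 < x \<Longrightarrow> x \<le> N \<Longrightarrow> 8 ^ card (prime_factors x) \<le> K"
  shows "real (card (coprime_params M Z)) \<le> n * K * real (card (lucas_values n N))"
proof -
  define X where "X = int (M * Z)"
  define f where "f = (\<lambda>(a, b). lucas_U a (- b) n)"
  note P = lucas_paramsD[OF _ M(1) Z, folded X_def]
  have X: "X > 0" "9 * int Z < X" using M Z by (simp_all add: X_def)
  have a0: "a > 0" if "(a, b) \<in> lucas_params M Z" for a b using P(5)[OF that] X by simp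
  have bX: "b \<le> X\<^sup>2" if "(a, b) \<in> lucas_params M Z" for a b
  proof -
    have "X * int Z \<le> X * X" using X by (intro mult_left_mono) auto
    then show ?thesis using P(7)[OF that] by (simp add: power2_eq_square)
  qed
  have range: "0 < f (a, b) \<and> f (a, b) \<le> N" if ab: "(a, b) \<in> lucas_params M Z" for a b
  proof -
    have "f (a, b) \<le> (4 * X) ^ (n - 1)"
      using lucas_U_neg_upper[of a X b "n - 1"] a0[OF ab] P(4,6)[OF ab] bX[OF ab] n
      by (simp add: f_def)
    also have "\<dots> \<le> N" using N by (simp add: X_def mult.assoc)
    finally show ?thesis
      using lucas_U_neg_pos[of a b "n - 1"] a0[OF ab] P(4)[OF ab] n by (simp add: f_def)
  qed
  have "f ` lucas_params M Z \<subseteq> lucas_values n N"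
  proof clarify
    fix a b assume ab: "(a, b) \<in> lucas_params M Z"
    have "f (a, b) = \<bar>lucas_U a (- b) n\<bar>" using range[OF ab] by (simp add: f_def)
    then show "f (a, b) \<in> lucas_values n N"
      using range[OF ab] nondegenerate_neg[OF a0[OF ab] P(4)[OF ab]]
      unfolding lucas_values_def mem_Collect_eq
      by (intro conjI exI[of _ a] exI[of _ "- b"]) auto
  qed
  then have le: "card (f ` lucas_params M Z) \<le> card (lucas_values n N)"
    by (intro card_mono finite_lucas_values)
  have "0 < 4 * M * Z" using Z M by simp
  then have "1 \<le> int (4 * M * Z)" by linarith
  then have "1 \<le> int (4 * M * Z) ^ (n - 1)" by (rule one_le_power)
  then have "1 \<le> N" using N by linarith
  then have K0: "K \<ge> 0" using K[of 1] by simp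
  have "real (card (lucas_params M Z)) \<le> (n * K) * real (card (f ` lucas_params M Z))"
  proof (rule card_le_card_image[OF finite_lucas_params])
    fix x assume "x \<in> f ` lucas_params M Z"
    then obtain a b where ab: "(a, b) \<in> lucas_params M Z" and x: "x = f (a, b)" by auto
    \<comment> \<open>Modulo \<open>M\<close>, \<open>x\<close> is congruent to
      \<open>a ^ (n - 1)\<close> and hence to 1, which makes it coprime to
      \<open>2 * n\<close>.\<close>
    have "b dvd x - a ^ (n - 1)" using lucas_U_mod_B[of "- b" a "n - 1"] n by (simp add: x f_def)
    then have "int M dvd x - a ^ (n - 1)" using P(3)[OF ab] dvd_trans by blast
    moreover have "a - 1 dvd a ^ (n - 1) - 1" by (simp add: power_diff_1_eq)
    then have "int M dvd a ^ (n - 1) - 1" using P(2)[OF ab] dvd_trans by blast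
    ultimately have "int M dvd (x - a ^ (n - 1)) + (a ^ (n - 1) - 1)" by (rule dvd_add)
    then have "int M dvd x - 1" by simp
    moreover have "int (2 * n) dvd int M" using M(2) by (simp only: of_nat_dvd_iff)
    ultimately have "int (2 * n) dvd x - 1" by (rule dvd_trans[rotated])
    then have x1: "2 * int n dvd x - 1" by simp
    have "coprime x (2 * int n)"
    proof (rule coprimeI)
      fix c assume c: "c dvd x" "c dvd 2 * int n"
      have "c dvd x - (x - 1)" by (rule dvd_diff[OF c(1) dvd_trans[OF c(2) x1]])
      then show "is_unit c" by simp
    qed
    then have "card {g \<in> lucas_params M Z. f g = x} \<le> n * 8 ^ card (prime_factors x)"
    proof (rule card_lucas_fibre_le[OF n X(1)])
      fix a b assume "(a, b) \<in> {g \<in> lucas_params M Z. f g = x}"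
      then show "lucas_U a (- b) n = x \<and> coprime a b \<and> X \<le> a \<and> 0 < b"
        using P by (auto simp: f_def)
      fix a' b' assume "(a', b') \<in> {g \<in> lucas_params M Z. f g = x}"
      \<comment> \<open>The bound \<open>X * Z\<close> on \<open>b'\<close>, sharper than
        \<open>X\<^sup>2\<close>, together with \<open>M > 9\<close> absorbs the constant 9 from
        squaring \<open>3 * X\<close>.\<close>
      then have "a\<^sup>2 * b' \<le> (3 * X)\<^sup>2 * (X * int Z)"
        using \<open>(a, b) \<in> _\<close> P(6)[of a b] P(4,7)[of a' b'] a0[of a b] X
        by (intro mult_mono power_mono) auto
      also have "\<dots> = X ^ 3 * (9 * int Z)" by (simp add: eval_nat_numeral)
      also have "\<dots> < X ^ 3 * X" using X by (intro mult_strict_left_mono) auto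
      also have "\<dots> = X ^ 4" by (simp add: eval_nat_numeral)
      finally show "a\<^sup>2 * b' < X ^ 4" .
    qed
    then have "real (card {g \<in> lucas_params M Z. f g = x}) \<le> real (n * 8 ^ card (prime_factors x))"
      by (simp only: of_nat_le_iff)
    also have "\<dots> \<le> n * K" using K[of x] range[OF ab] x by (simp add: mult_left_mono)
    finally show "real (card {g \<in> lucas_params M Z. f g = x}) \<le> n * K" .
  qed
  also have "\<dots> \<le> (n * K) * real (card (lucas_values n N))"
    using le K0 by (intro mult_left_mono) auto
  finally show ?thesis using M by (simp add: card_lucas_params)
qed

lemma eventually_card_lucas_values_ge:
  assumes n: "n \<ge> 5"
  shows "\<exists>c>0. \<forall>\<^sub>F y::real in at_top. \<forall>N::int. real_of_int N = y \<longrightarrow>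
    c * y powr (3 / (real n - 1) - 4 / ln (ln y)) \<le> real (card (lucas_values n N))"
proof -
  \<comment> \<open>For \<open>n\<close> at least 5 this factorial is divisible by
    \<open>2 * n\<close> and by all primes up to 10.\<close>
  define M :: nat where "M = fact (2 * n)"
  define d where "d = 1 / (real n - 1)"
  have d: "d > 0" using n by (simp add: d_def)
  have "2 * n \<le> M" unfolding M_def by (rule fact_ge_self)
  then have M9: "M > 9" using n by simp
  have M2: "2 * n dvd M" unfolding M_def using n by (intro dvd_fact) auto
  have Mp: "p dvd M" if "prime p" "p \<le> 10" for p
    unfolding M_def using that n prime_gt_0_nat[of p] by (intro dvd_fact) auto
  \<comment> \<open>Chosen as large as \<open>(4 * M * Z) ^ (n - 1)\<close> at most \<open>y\<close>
    permits. Once the argument of the floor is at least 2, rounding loses at most a factor 2, hence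
    the 8 in \<open>c\<close>; the remaining factor \<open>2 * n\<close> comes from the density 1/2
    and the fibre bound.\<close>
  define Z where "Z y = nat \<lfloor>y powr d / (4 * real M)\<rfloor>" for y
  define c where "c = 1 / (2 * n * (8 * real M) ^ 3)"
  have c: "c > 0" using n M9 by (simp add: c_def)
  have lim: "filterlim (\<lambda>y. y powr d / (4 * real M)) at_top at_top"
    using d M9 by real_asymp
  have "\<forall>\<^sub>F y in at_top. y powr d / (4 * real M) \<ge> 2"
    using lim by (simp add: filterlim_at_top)
  moreover have "\<forall>\<^sub>F z::real in at_top. z\<^sup>2 * (1 + ln (z\<^sup>2)) \<le> 3 / 10 * z ^ 3" by real_asymp
  then have ev: "\<forall>\<^sub>F k::nat in at_top. (real k)\<^sup>2 * (1 + ln ((real k)\<^sup>2)) \<le> 3 / 10 * real k ^ 3"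
    by (rule eventually_compose_filterlim) (rule filterlim_real_sequentially)
  moreover have "filterlim Z at_top at_top"
    unfolding Z_def
    by (intro filterlim_compose[OF filterlim_nat_sequentially] filterlim_compose[OF filterlim_floor_sequentially] lim)
  then have "\<forall>\<^sub>F y in at_top. (real (Z y))\<^sup>2 * (1 + ln ((real (Z y))\<^sup>2)) \<le> 3 / 10 * real (Z y) ^ 3"
    by (rule eventually_compose_filterlim[OF ev])
  ultimately have "\<forall>\<^sub>F y in at_top. y powr d / (4 * real M) \<ge> 2 \<and>
     (real (Z y))\<^sup>2 * (1 + ln ((real (Z y))\<^sup>2)) \<le> 3 / 10 * real (Z y) ^ 3"
    by (intro eventually_conj)
  then have "\<forall>\<^sub>F y in at_top. \<forall>N::int. real_of_int N = y \<longrightarrow>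
    c * y powr (3 / (real n - 1) - 4 / ln (ln y)) \<le> real (card (lucas_values n N))"
    using eventually_pow8_card_prime_factors_le eventually_gt_at_top[of 1]
  proof eventually_elim
    case (elim y)
    show ?case
    proof (intro allI impI)
      fix N :: int assume N: "real_of_int N = y"
      let ?r = "y powr d / (4 * real M)" and ?K = "y powr (4 / ln (ln y))"
      have Zr: "real (Z y) \<le> ?r" "?r - 1 \<le> real (Z y)" using elim by (auto simp: Z_def)
      then have Zlow: "y powr d / (8 * real M) \<le> real (Z y)" using elim by simp
      have Zpos: "Z y > 0" using Zr elim by linarith
      have "real (4 * M * Z y) \<le> y powr d" using Zr(1) M9 by (simp add: field_simps)
      then have "real (4 * M * Z y) ^ (n - 1) \<le> (y powr d) ^ (n - 1)" by (intro power_mono) auto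
      also have "\<dots> = y powr (d * real (n - 1))" using elim by (simp add: powr_power mult.commute)
      also have "\<dots> = real_of_int N" using n elim N by (simp add: d_def of_nat_diff)
      finally have "real_of_int (int (4 * M * Z y) ^ (n - 1)) \<le> real_of_int N" by simp
      then have "int (4 * M * Z y) ^ (n - 1) \<le> N" by (simp only: of_int_le_iff)
      then have "real (card (coprime_params M (Z y))) \<le> n * ?K * real (card (lucas_values n N))"
        using card_lucas_values_ge[OF n M9 M2 Zpos] elim N by simp
      moreover have "real (Z y) ^ 3 / 2 \<le> real (card (coprime_params M (Z y)))"
        using card_coprime_params_ge[OF Mp] elim Zpos by simp
      moreover have "(y powr d / (8 * real M)) ^ 3 \<le> real (Z y) ^ 3"
        using Zlow by (intro power_mono) auto
      ultimately have main: "(y powr d / (8 * real M)) ^ 3 / 2 \<le> n * ?K * real (card (lucas_values n N))"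
        by linarith
      have "c * y powr (3 / (real n - 1) - 4 / ln (ln y)) = c * y powr (3 * d) / ?K"
        by (simp add: powr_diff d_def)
      also have "y powr (3 * d) = (y powr d) ^ 3"
        using elim by (simp add: powr_powr mult.commute flip: powr_realpow)
      also have "c * (y powr d) ^ 3 / ?K = ((y powr d / (8 * real M)) ^ 3 / 2) / (n * ?K)"
        by (simp add: c_def power_divide)
      also have "\<dots> \<le> real (card (lucas_values n N))"
        using main n elim by (simp add: pos_divide_le_eq mult.commute)
      finally show "c * y powr (3 / (real n - 1) - 4 / ln (ln y)) \<le> real (card (lucas_values n N))" .
    qed
  qed
  then show ?thesis using c by blast
qed

theorem theorem2p6:
  fixes n :: nat
  assumes "n \<ge> 5"
  shows "\<exists>c\<^sub>2::real. c\<^sub>2 > 0 \<and>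
    (\<forall>N::int. N \<ge> 3 \<longrightarrow> card (lucas_values n N) > 0 \<longrightarrow>
       real (card (lucas_values n N))
         \<ge> c\<^sub>2 * real_of_int N powr (3 / (real n - 1) - 4 / ln (ln (real_of_int N)))) \<and>
    (\<forall>N::int. N \<ge> 3 \<longrightarrow> card (lucas_values_ge n N) > 0 \<longrightarrow>
       real (card (lucas_values_ge n N))
         \<ge> c\<^sub>2 * real_of_int N powr (3 / (real n - 1) - 4 / ln (ln (real_of_int N))))"
proof -
  define E :: "int \<Rightarrow> real" where "E N = real_of_int N powr (3 / (real n - 1) - 4 / ln (ln (real_of_int N)))" for N
  obtain c Y where c: "c > 0"
    and large: "\<And>N. real_of_int N \<ge> Y \<Longrightarrow> c * E N \<le> real (card (lucas_values n N))"
    using eventually_card_lucas_values_ge[OF assms] unfolding eventually_at_top_linorder E_def by blast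
  define Y' where "Y' = max Y 1"
  \<comment> \<open>The second entry makes the lower bound at most 1 for \<open>N\<close> below
    \<open>Y\<close>, where it suffices that the set of values is nonempty.\<close>
  define c2 where "c2 = min c (1 / Y' powr (3 / (real n - 1)))"
  have Y': "Y' \<ge> 1" by (simp add: Y'_def)
  have E0: "E N \<ge> 0" for N by (simp add: E_def)
  have c2: "c2 > 0" "c2 * E N \<le> c * E N" for N
    using c Y' E0 by (auto simp: c2_def intro: mult_right_mono)
  have small: "c2 * E N \<le> 1" if N: "N \<ge> 3" "real_of_int N < Y" for N
  proof -
    \<comment> \<open>For \<open>N\<close> at least 3 > e, \<open>ln (ln N)\<close> is nonnegative,
      so the subtracted term only lowers the exponent.\<close>
    have "exp 1 \<le> real_of_int N" using N exp_le by linarith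
    then have "1 \<le> ln (real_of_int N)" using N by (subst ln_ge_iff) auto
    then have "3 / (real n - 1) - 4 / ln (ln (real_of_int N)) \<le> 3 / (real n - 1)" by simp
    then have "E N \<le> real_of_int N powr (3 / (real n - 1))"
      unfolding E_def using N by (intro powr_mono) auto
    also have "\<dots> \<le> Y' powr (3 / (real n - 1))"
      using N assms by (intro powr_mono2) (auto simp: Y'_def)
    finally have "c2 * E N \<le> (1 / Y' powr (3 / (real n - 1))) * Y' powr (3 / (real n - 1))"
      using E0 by (intro mult_mono) (auto simp: c2_def)
    then show ?thesis using Y' by simp
  qed
  \<comment> \<open>A general \<open>k\<close> lets the same argument serve both
    cardinalities.\<close>
  have card_ge: "c2 * E N \<le> real k"
    if "N \<ge> 3" "k > 0" "card (lucas_values n N) \<le> k" for N k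
  proof (cases "real_of_int N < Y")
    case True
    then show ?thesis using small[OF that(1)] that(2) by linarith
  next
    case False
    then show ?thesis using large[of N] c2(2)[of N] that(3) by linarith
  qed
  have "lucas_values n N \<subseteq> lucas_values_ge n N" for N by (auto simp: lucas_values_ge_def)
  then have "card (lucas_values n N) \<le> card (lucas_values_ge n N)" for N
    by (intro card_mono finite_lucas_values_ge)
  then show ?thesis using c2(1) card_ge unfolding E_def by blast
qed

end
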